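(* Let $Q$ be a quiver with no self-loops or $2$-cycles (which may or may not be decorated), and let $\mathrm{g}(Q)=\gcd\{\mathrm{a}(x,y)\mid x,y\in\mathrm{verts}(Q)\}$. For any vertex $m$ of $Q$ we have $\mathrm{g}(Q)=\mathrm{g}(\mathrm{mut}_m(Q))$.
   Context: All quivers have finitely many vertices and finitely many arrows between any two vertices. For vertices $x,y$ of a quiver without self-loops or $2$-cycles, $\mathrm{a}(x,y)$ is the signed number of arrows between them: positive if arrows point from $x$ to $y$, negative if from $y$ to $x$, zero if there are none. The gcd is taken to be non-negative, and is $0$ if all $\mathrm{a}(x,y)$ vanish. The underlying quiver of $\mathrm{mut}_m(Q)$ is the usual quiver mutation at $m$: for every path $t\to m\to h$ add an arrow $t\to h$; reverse all arrows incident at $m$; cancel all $2$-cycles. (Vertex labels, if any, play no role in $\mathrm{g}$.) *)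

theory Defs
  imports "Graph_Theory.Digraph"
begin

definition two_cycle :: "('v, 'e) pre_digraph \<Rightarrow> 'e \<Rightarrow> 'e \<Rightarrow> bool" where
  "two_cycle G e f \<longleftrightarrow> e \<in> arcs G \<and> f \<in> arcs G \<and> tail G e \<noteq> head G e \<and>
     tail G e = head G f \<and> head G e = tail G f"

locale cluster_quiver = fin_digraph + loopfree_digraph +
  assumes no_two_cycles: "\<not> two_cycle G e f"

definition arrows_between :: "('v, 'e, 'd) pre_digraph_scheme \<Rightarrow> 'v \<Rightarrow> 'v \<Rightarrow> 'e set" where
  "arrows_between G x y = {e \<in> arcs G. tail G e = x \<and> head G e = y}"

text \<open>If there are no 2-cycles, at most one of the two cardinalities is nonzero.\<close>

definition signed_arrows :: "('v, 'e, 'd) pre_digraph_scheme \<Rightarrow> 'v \<Rightarrow> 'v \<Rightarrow> int" where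
  "signed_arrows G x y = int (card (arrows_between G x y)) - int (card (arrows_between G y x))"

definition arrow_gcd :: "('v, 'e, 'd) pre_digraph_scheme \<Rightarrow> int" where
  "arrow_gcd G = Gcd {signed_arrows G x y | x y. x \<in> verts G \<and> y \<in> verts G}"

text \<open>Old arrows are tagged \<^const>\<open>Inl\<close>; the arrow added for a path \<open>t \<rightarrow> m \<rightarrow> h\<close>, given by
  its two consecutive arrows, is tagged \<^const>\<open>Inr\<close>.\<close>

definition add_path_arrows :: "'v \<Rightarrow> ('v, 'e) pre_digraph \<Rightarrow> ('v, 'e + 'e \<times> 'e) pre_digraph" where
  "add_path_arrows m G =
     \<lparr>verts = verts G,
      arcs = Inl ` arcs G \<union>
        Inr ` {(e, f). e \<in> arcs G \<and> f \<in> arcs G \<and> head G e = m \<and> tail G f = m},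
      tail = case_sum (tail G) (\<lambda>(e, f). tail G e),
      head = case_sum (head G) (\<lambda>(e, f). head G f)\<rparr>"

definition reverse_at :: "'v \<Rightarrow> ('v, 'e) pre_digraph \<Rightarrow> ('v, 'e) pre_digraph" where
  "reverse_at m G = G
     \<lparr>tail := \<lambda>e. if tail G e = m \<or> head G e = m then head G e else tail G e,
      head := \<lambda>e. if tail G e = m \<or> head G e = m then tail G e else head G e\<rparr>"

inductive cancels_to :: "('v, 'e) pre_digraph \<Rightarrow> ('v, 'e) pre_digraph \<Rightarrow> bool" where
  cancels_to_refl: "cancels_to G G"
| cancels_to_step: "two_cycle G e f \<Longrightarrow> cancels_to (G\<lparr>arcs := arcs G - {e, f}\<rparr>) H \<Longrightarrow> cancels_to G H"

definition cancels_fully_to :: "('v, 'e) pre_digraph \<Rightarrow> ('v, 'e) pre_digraph \<Rightarrow> bool" where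
  "cancels_fully_to G H \<longleftrightarrow> cancels_to G H \<and> (\<nexists>e f. two_cycle H e f)"

text \<open>Mutation is a relation because there is a choice of which arrows to cancel (the outcome is
  unique only up to renaming of arrows). A decorated quiver is a record extending
  \<^type>\<open>pre_digraph\<close>; \<^const>\<open>pre_digraph.truncate\<close> gives its underlying quiver. The decoration
  of the mutated quiver is left arbitrary, so every rule for mutating decorations is covered.\<close>

definition is_mutation ::
  "'v \<Rightarrow> ('v, 'e, 'd) pre_digraph_scheme \<Rightarrow> ('v, 'e + 'e \<times> 'e, 'd2) pre_digraph_scheme \<Rightarrow> bool" where
  "is_mutation m Q Q' \<longleftrightarrow>
     cancels_fully_to (reverse_at m (add_path_arrows m (pre_digraph.truncate Q)))
       (pre_digraph.truncate Q')"

lemma cancels_fully_to_exists: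
  assumes "finite (arcs G)"
  shows "\<exists>H. cancels_fully_to G H"
  using assms
proof (induction "card (arcs G)" arbitrary: G rule: less_induct)
  case less
  show ?case
  proof (cases "\<exists>e f. two_cycle G e f")
    case True
    then obtain e f where ef: "two_cycle G e f" by blast
    let ?G = "G\<lparr>arcs := arcs G - {e, f}\<rparr>"
    from ef have "arcs ?G \<subset> arcs G" by (auto simp: two_cycle_def)
    with less.prems have "card (arcs ?G) < card (arcs G)" by (rule psubset_card_mono)
    with less obtain H where "cancels_fully_to ?G H" by fastforce
    with ef show ?thesis unfolding cancels_fully_to_def by (blast intro: cancels_to_step)
  next
    case False
    then show ?thesis unfolding cancels_fully_to_def by (blast intro: cancels_to_refl)
  qed
qed

lemma is_mutation_exists:
  fixes Q :: "('v, 'e, 'd) pre_digraph_scheme" and m :: 'v and decoration :: 'd2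
  assumes "cluster_quiver (pre_digraph.truncate Q)"
  shows "\<exists>Q'. is_mutation m Q Q' \<and> pre_digraph.more Q' = decoration"
proof -
  interpret cluster_quiver "pre_digraph.truncate Q" by (rule assms)
  let ?G = "pre_digraph.truncate Q"
  have "finite {(e, f). e \<in> arcs ?G \<and> f \<in> arcs ?G \<and> head ?G e = m \<and> tail ?G f = m}"
    by (rule finite_subset[of _ "arcs ?G \<times> arcs ?G"]) auto
  then have "finite (arcs (reverse_at m (add_path_arrows m ?G)))"
    by (simp add: reverse_at_def add_path_arrows_def)
  then obtain H where "cancels_fully_to (reverse_at m (add_path_arrows m ?G)) H"
    using cancels_fully_to_exists by blast
  moreover have "pre_digraph.truncate (pre_digraph.extend H decoration) = H"
    by (simp add: pre_digraph.defs)
  moreover have "pre_digraph.more (pre_digraph.extend H decoration) = decoration"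
    by (simp add: pre_digraph.defs)
  ultimately show ?thesis unfolding is_mutation_def by metis
qed

end

(* Write p(x,y) for the number of arrows from x to y. Without 2-cycles p(x,y) and p(y,x) are 0 or
   \<plusminus>a(x,y), so d divides a(x,y) iff it divides both. Mutation at m negates a(x,m) and changes
   the other a(x,y) by p(x,m) p(m,y) - p(y,m) p(m,x), which every common divisor of the a(x,m)
   divides. Hence Q and its mutation have the same common divisors. *)
theory Submission
  imports Defs
begin

lemma dvd_arrow_gcd_iff:
  "d dvd arrow_gcd G \<longleftrightarrow> (\<forall>x\<in>verts G. \<forall>y\<in>verts G. d dvd signed_arrows G x y)"
  unfolding arrow_gcd_def dvd_Gcd_iff by blast

text \<open>Mutual divisibility of integers gives equality only up to sign; non-negativity of
  \<open>Gcd\<close> settles the sign. It then suffices to compare common divisors.\<close>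

lemma arrow_gcd_eqI:
  assumes "\<And>d. d dvd arrow_gcd G \<longleftrightarrow> d dvd arrow_gcd H"
  shows "arrow_gcd G = arrow_gcd H"
proof (rule zdvd_antisym_nonneg)
  show "arrow_gcd G dvd arrow_gcd H" "arrow_gcd H dvd arrow_gcd G"
    using assms[of "arrow_gcd G"] assms[of "arrow_gcd H"] by simp_all
qed (simp_all add: arrow_gcd_def)

lemma signed_arrows_truncate [simp]:
  "signed_arrows (pre_digraph.truncate G) = signed_arrows G"
  by (simp add: signed_arrows_def arrows_between_def pre_digraph.defs fun_eq_iff)

lemma arrow_gcd_truncate [simp]: "arrow_gcd (pre_digraph.truncate G) = arrow_gcd G"
  unfolding arrow_gcd_def signed_arrows_truncate by (simp add: pre_digraph.defs)

text \<open>Additive form, suited to deleting arrows: each arrow contributes 1, -1 or 0, a loop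
  always 0.\<close>

lemma signed_arrows_eq_sum:
  assumes "finite (arcs G)"
  shows "signed_arrows G x y =
    (\<Sum>e\<in>arcs G. of_bool (tail G e = x \<and> head G e = y) - of_bool (tail G e = y \<and> head G e = x))"
proof -
  have "arrows_between G u v = arcs G \<inter> {e. tail G e = u \<and> head G e = v}" for u v
    by (auto simp: arrows_between_def)
  with assms show ?thesis
    by (simp only: signed_arrows_def sum_subtractf sum_of_bool_eq)
qed

lemma signed_arrows_delete_two_cycle:
  assumes "finite (arcs G)" "two_cycle G e f"
  shows "signed_arrows (G\<lparr>arcs := arcs G - {e, f}\<rparr>) x y = signed_arrows G x y"
proof -
  let ?c = "\<lambda>e. of_bool (tail G e = x \<and> head G e = y) - of_bool (tail G e = y \<and> head G e = x) :: int"
  have ef: "e \<noteq> f" "{e, f} \<subseteq> arcs G" "tail G e = head G f" "head G e = tail G f"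
    using assms(2) by (auto simp: two_cycle_def)
  have "sum ?c {e, f} = ?c e + ?c f"
    using ef(1) by simp
  \<comment> \<open>The arrows of a 2-cycle run in opposite directions, so their contributions
    differ by sign.\<close>
  also have "\<dots> = 0"
    unfolding ef(3,4) by (simp add: conj_commute)
  finally have "sum ?c (arcs G) = sum ?c (arcs G - {e, f})"
    using sum.subset_diff[OF ef(2) assms(1), of ?c] by simp
  with assms(1) show ?thesis
    by (simp add: signed_arrows_eq_sum)
qed

text \<open>Each single cancellation keeps all signed counts, so the choice of 2-cycles to cancel
  cannot affect the gcd.\<close>

lemma cancels_to_invariants:
  assumes "cancels_to G H" "finite (arcs G)"
  shows "verts H = verts G \<and> signed_arrows H = signed_arrows G"
  using assms
proof induction
  case (cancels_to_step G e f H)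
  then show ?case
    by (simp add: signed_arrows_delete_two_cycle fun_eq_iff)
qed simp

lemma arrow_gcd_cancels_to:
  assumes "cancels_to G H" "finite (arcs G)"
  shows "arrow_gcd H = arrow_gcd G"
  using cancels_to_invariants[OF assms] by (simp add: arrow_gcd_def)

text \<open>An added arrow is a pair of arrows through \<open>m\<close>, hence the product; the tags
  keep old and added arrows apart, so cardinalities will add up.\<close>

lemma arrows_between_add_path_arrows:
  "arrows_between (add_path_arrows m G) x y =
    Inl ` arrows_between G x y \<union> Inr ` (arrows_between G x m \<times> arrows_between G m y)"
  by (auto simp: arrows_between_def add_path_arrows_def)

lemma arrows_between_reverse_at:
  "arrows_between (reverse_at m G) x y =
    (if x = m \<or> y = m then arrows_between G y x else arrows_between G x y)"
  by (auto simp: arrows_between_def reverse_at_def)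

lemma finite_arcs_add_path_arrows:
  assumes "finite (arcs G)"
  shows "finite (arcs (add_path_arrows m G))"
proof -
  have "finite {(e, f). e \<in> arcs G \<and> f \<in> arcs G \<and> head G e = m \<and> tail G f = m}"
    by (rule finite_subset[of _ "arcs G \<times> arcs G"]) (use assms in auto)
  with assms show ?thesis by (simp add: add_path_arrows_def)
qed

context cluster_quiver
begin

lemma finite_arrows_between [simp]: "finite (arrows_between G x y)"
  by (simp add: arrows_between_def)

lemma arrows_between_self [simp]: "arrows_between G x x = {}"
  by (auto simp: arrows_between_def dest: no_loops)

lemma arrows_between_empty_or: "arrows_between G x y = {} \<or> arrows_between G y x = {}"
proof (rule ccontr)
  assume "\<not> ?thesis"
  then obtain e f where "e \<in> arrows_between G x y" "f \<in> arrows_between G y x" by blast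
  \<comment> \<open>\<open>two_cycle\<close> asks for distinct ends, which loop-freeness
    guarantees.\<close>
  then have "two_cycle G e f"
    by (auto simp: arrows_between_def two_cycle_def dest: no_loops)
  with no_two_cycles show False by blast
qed

text \<open>One of the two counts is 0, so the difference is the other up to sign. This gives access
  to the factors of the products that mutation adds.\<close>

lemma dvd_signed_arrows_iff:
  "d dvd signed_arrows G x y \<longleftrightarrow>
    d dvd int (card (arrows_between G x y)) \<and> d dvd int (card (arrows_between G y x))"
  using arrows_between_empty_or[of x y] by (auto simp: signed_arrows_def)

lemma card_arrows_between_add_path_arrows:
  "card (arrows_between (add_path_arrows m G) x y) = card (arrows_between G x y) +
    card (arrows_between G x m) * card (arrows_between G m y)"
  unfolding arrows_between_add_path_arrows
  by (subst card_Un_disjoint) (auto simp: card_image card_cartesian_product)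

text \<open>If \<open>x\<close> or \<open>y\<close> is \<open>m\<close>, each product has a factor
  counting loops at \<open>m\<close>, which is 0; only the sign change from the reversal
  remains.\<close>

lemma signed_arrows_reverse_add_path_arrows:
  "signed_arrows (reverse_at m (add_path_arrows m G)) x y =
    (if x = m \<or> y = m then - signed_arrows G x y
     else signed_arrows G x y +
       int (card (arrows_between G x m)) * int (card (arrows_between G m y)) -
       int (card (arrows_between G y m)) * int (card (arrows_between G m x)))"
  by (auto simp: signed_arrows_def arrows_between_reverse_at card_arrows_between_add_path_arrows)

text \<open>Before cancellation the new quiver may have 2-cycles, so
  \<open>dvd_signed_arrows_iff\<close> is applied to \<open>G\<close> alone.
  \<open>m \<in> verts G\<close> puts the a(x,m) among the numbers whose gcd is taken.\<close>

lemma arrow_gcd_reverse_add_path_arrows: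
  assumes "m \<in> verts G"
  shows "arrow_gcd (reverse_at m (add_path_arrows m G)) = arrow_gcd G"
    (is "arrow_gcd ?H = _")
proof (rule arrow_gcd_eqI)
  fix d
  have verts: "verts ?H = verts G"
    by (simp add: reverse_at_def add_path_arrows_def)
  have at_m: "d dvd signed_arrows ?H x m \<longleftrightarrow> d dvd signed_arrows G x m" for x
    by (simp add: signed_arrows_reverse_add_path_arrows)
  \<comment> \<open>The assumptions speak of \<open>G\<close> only, so this one equivalence serves
    both directions.\<close>
  have eq: "d dvd signed_arrows ?H x y \<longleftrightarrow> d dvd signed_arrows G x y"
    if "d dvd signed_arrows G x m" "d dvd signed_arrows G y m" for x y
  proof -
    \<comment> \<open>Each product has a factor p(x,m) or p(m,x), and \<open>d\<close> divides both
      because it divides a(x,m).\<close>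
    have "d dvd int (card (arrows_between G x m)) * int (card (arrows_between G m y)) -
        int (card (arrows_between G y m)) * int (card (arrows_between G m x))"
      using that by (simp add: dvd_signed_arrows_iff)
    then show ?thesis
      unfolding signed_arrows_reverse_add_path_arrows
      by (auto simp only: add_diff_eq[symmetric] dvd_add_left_iff dvd_minus_iff split: if_split)
  qed
  show "d dvd arrow_gcd ?H \<longleftrightarrow> d dvd arrow_gcd G"
  proof
    assume "d dvd arrow_gcd ?H"
    then have H: "d dvd signed_arrows ?H x y" if "x \<in> verts G" "y \<in> verts G" for x y
      using that by (simp only: dvd_arrow_gcd_iff verts)
    show "d dvd arrow_gcd G"
      unfolding dvd_arrow_gcd_iff
    proof (intro ballI)
      fix x y assume xy: "x \<in> verts G" "y \<in> verts G"
      \<comment> \<open>Counts at \<open>m\<close> only change sign, so divisibility passes from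
        \<open>?H\<close> back to \<open>G\<close>, as \<open>eq\<close> requires.\<close>
      have "d dvd signed_arrows G x m" "d dvd signed_arrows G y m"
        using H[OF xy(1) assms] H[OF xy(2) assms] by (simp_all only: at_m)
      from eq[OF this] H[OF xy] show "d dvd signed_arrows G x y" ..
    qed
  next
    assume "d dvd arrow_gcd G"
    then have G: "d dvd signed_arrows G x y" if "x \<in> verts G" "y \<in> verts G" for x y
      using that by (simp only: dvd_arrow_gcd_iff)
    show "d dvd arrow_gcd ?H"
      unfolding dvd_arrow_gcd_iff verts
    proof (intro ballI)
      fix x y assume xy: "x \<in> verts G" "y \<in> verts G"
      from eq[OF G[OF xy(1) assms] G[OF xy(2) assms]] G[OF xy]
      show "d dvd signed_arrows ?H x y" ..
    qed
  qed
qed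

end

theorem proposition4p11:
  fixes Q :: "('v, 'e, 'd) pre_digraph_scheme"
    and Q' :: "('v, 'e + 'e \<times> 'e, 'd2) pre_digraph_scheme"
    and m :: 'v
  assumes "cluster_quiver (pre_digraph.truncate Q)"
    and "m \<in> verts Q"
    and "is_mutation m Q Q'"
  shows "arrow_gcd Q = arrow_gcd Q'"
proof -
  interpret cluster_quiver "pre_digraph.truncate Q" by (rule assms)
  let ?H = "reverse_at m (add_path_arrows m (pre_digraph.truncate Q))"
  have "m \<in> verts (pre_digraph.truncate Q)"
    using assms(2) by (simp add: pre_digraph.defs)
  then have "arrow_gcd ?H = arrow_gcd (pre_digraph.truncate Q)"
    by (rule arrow_gcd_reverse_add_path_arrows)
  \<comment> \<open>An infinite set has \<open>card\<close> 0, so without finiteness cancellation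
    could change signed counts.\<close>
  moreover have "finite (arcs ?H)"
    using finite_arcs_add_path_arrows[OF finite_arcs] by (simp add: reverse_at_def)
  moreover have "cancels_to ?H (pre_digraph.truncate Q')"
    using assms(3) unfolding is_mutation_def cancels_fully_to_def by (rule conjunct1)
  ultimately have "arrow_gcd (pre_digraph.truncate Q') = arrow_gcd (pre_digraph.truncate Q)"
    using arrow_gcd_cancels_to[of ?H "pre_digraph.truncate Q'"] by (simp only:)
  then show ?thesis by (simp only: arrow_gcd_truncate)
qed

end
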